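(* Let $\{F^{ij}\}_{1\le i<j\le 4}$ be a sextuple of real fundamental matrices such that in each image all three epipoles coincide, i.e. for each $i\in\{1,2,3,4\}$ the three epipoles $e_i^j$, $j\neq i$, are equal as points of $\mathbb{P}^2$. Then $\{F^{ij}\}$ is compatible if and only if each triple $\{F^{ij},F^{ik},F^{jk}\}$, for distinct $i,j,k\in\{1,2,3,4\}$, is compatible.
   Context: Everything is over $\mathbb{R}$. A camera is a rank-3 real $3\times 4$ matrix (up to nonzero scale); a fundamental matrix is a rank-2 real $3\times 3$ matrix (up to nonzero scale). For $3\times 4$ matrices $P_1,P_2$, $\psi(P_1,P_2)$ is the $3\times3$ matrix $F$ (up to scale) with $\det\begin{bmatrix}P_1&x&0\\P_2&0&y\end{bmatrix}=x^TFy$ for all $x,y\in\mathbb{R}^3$. Convention: $F^{ji}=(F^{ij})^T$. A set $\{F^{ij}\}$ is compatible if there are cameras $P_i$, one for each index occurring, with $F^{ij}=\psi(P_i,P_j)$ up to nonzero scale for all given $(i,j)$. The epipole $e_j^i$ (the $i$-th epipole in the $j$-th image) is a vector spanning $\ker F^{ij}$, viewed as a point of $\mathbb{P}^2$. *)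

theory Defs
  imports "HOL-Analysis.Analysis"
begin

(* Matrices are concrete representatives; "up to nonzero scale" and equality of
   points of the projective plane are both expressed by this relation. *)
definition eq_up_to_scale :: "'a::real_vector \<Rightarrow> 'a \<Rightarrow> bool" where
  "eq_up_to_scale u v \<longleftrightarrow> (\<exists>c. c \<noteq> 0 \<and> u = c *\<^sub>R v)"

definition camera :: "real^4^3 \<Rightarrow> bool" where
  "camera P \<longleftrightarrow> rank P = 3"

definition fundamental_matrix :: "real^3^3 \<Rightarrow> bool" where
  "fundamental_matrix F \<longleftrightarrow> rank F = 2"

definition two_view_matrix :: "real^4^3 \<Rightarrow> real^4^3 \<Rightarrow> real^3 \<Rightarrow> real^3 \<Rightarrow> real^6^6" where
  "two_view_matrix P Q x y = vector
     [vector [P$1$1, P$1$2, P$1$3, P$1$4, x$1, 0],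
      vector [P$2$1, P$2$2, P$2$3, P$2$4, x$2, 0],
      vector [P$3$1, P$3$2, P$3$3, P$3$4, x$3, 0],
      vector [Q$1$1, Q$1$2, Q$1$3, Q$1$4, 0, y$1],
      vector [Q$2$1, Q$2$2, Q$2$3, Q$2$4, 0, y$2],
      vector [Q$3$1, Q$3$2, Q$3$3, Q$3$4, 0, y$3]]"

definition \<psi> :: "real^4^3 \<Rightarrow> real^4^3 \<Rightarrow> real^3^3" where
  "\<psi> P Q = (THE F. \<forall>x y. det (two_view_matrix P Q x y) = x \<bullet> (F *v y))"

lemma exhaust_6:
  fixes i :: 6
  shows "i = 1 \<or> i = 2 \<or> i = 3 \<or> i = 4 \<or> i = 5 \<or> i = 6"
proof (induct i)
  case (of_int z)
  then have "z \<in> {0, 1, 2, 3, 4, 5}" by auto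
  then show ?case by auto
qed

lemma forall_6: "(\<forall>i::6. P i) \<longleftrightarrow> P 1 \<and> P 2 \<and> P 3 \<and> P 4 \<and> P 5 \<and> P 6"
  by (metis exhaust_6)

lemma vector_6:
  "(vector [a,b,c,d,e,f] :: 'a::zero^6)$1 = a"
  "(vector [a,b,c,d,e,f] :: 'a^6)$2 = b"
  "(vector [a,b,c,d,e,f] :: 'a^6)$3 = c"
  "(vector [a,b,c,d,e,f] :: 'a^6)$4 = d"
  "(vector [a,b,c,d,e,f] :: 'a^6)$5 = e"
  "(vector [a,b,c,d,e,f] :: 'a^6)$6 = f"
  unfolding vector_def by simp_all

lemma linear_det_row: "linear (\<lambda>v::real^'n. det (\<chi> i. if i = k then v else c i))"
proof (rule linearI)
  fix u v :: "real^'n" and r :: real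
  show "det (\<chi> i. if i = k then u + v else c i) =
      det (\<chi> i. if i = k then u else c i) + det (\<chi> i. if i = k then v else c i)"
    by (rule det_row_add)
  show "det (\<chi> i. if i = k then r *\<^sub>R u else c i) =
      r *\<^sub>R det (\<chi> i. if i = k then u else c i)"
    using det_row_mul[of k r "\<lambda>_. u" c] unfolding scalar_mult_eq_scaleR by simp
qed

lemma linear_det_two_view_left: "linear (\<lambda>x. det (two_view_matrix P Q x y))"
proof -
  let ?w = "\<lambda>x::real^3. vector [x$1, x$2, x$3, 0, 0, 0] :: real^6"
  define c where "c = (\<lambda>i. transpose (two_view_matrix P Q 0 y) $ i)"
  have eq: "transpose (two_view_matrix P Q x y) = (\<chi> i. if i = 5 then ?w x else c i)" for x
    unfolding vec_eq_iff forall_6 by (simp add: c_def transpose_def two_view_matrix_def vector_6)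
  have "linear ?w"
    by (rule linearI) (simp_all add: vec_eq_iff forall_6 vector_6)
  from linear_compose[OF this linear_det_row[of 5 c]]
  have "linear (\<lambda>x. det (transpose (two_view_matrix P Q x y)))"
    unfolding eq by (simp add: o_def)
  then show ?thesis by (simp add: det_transpose)
qed

lemma linear_det_two_view_right: "linear (\<lambda>y. det (two_view_matrix P Q x y))"
proof -
  let ?w = "\<lambda>y::real^3. vector [0, 0, 0, y$1, y$2, y$3] :: real^6"
  define c where "c = (\<lambda>i. transpose (two_view_matrix P Q x 0) $ i)"
  have eq: "transpose (two_view_matrix P Q x y) = (\<chi> i. if i = 6 then ?w y else c i)" for y
    unfolding vec_eq_iff forall_6 by (simp add: c_def transpose_def two_view_matrix_def vector_6)
  have "linear ?w"
    by (rule linearI) (simp_all add: vec_eq_iff forall_6 vector_6)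
  from linear_compose[OF this linear_det_row[of 6 c]]
  have "linear (\<lambda>y. det (transpose (two_view_matrix P Q x y)))"
    unfolding eq by (simp add: o_def)
  then show ?thesis by (simp add: det_transpose)
qed

lemma ex1_\<psi>: "\<exists>!F. \<forall>x y. det (two_view_matrix P Q x y) = x \<bullet> (F *v y)"
proof (rule ex1I)
  define F :: "real^3^3" where "F = (\<chi> i j. det (two_view_matrix P Q (axis i 1) (axis j 1)))"
  have "det (two_view_matrix P Q x y) = x \<bullet> (F *v y)" for x y
  proof -
    have "det (two_view_matrix P Q x y) =
        det (two_view_matrix P Q (\<Sum>i\<in>UNIV. x$i *\<^sub>R axis i 1) y)"
      using basis_expansion[of x] by (simp only: scalar_mult_eq_scaleR)
    also have "\<dots> = (\<Sum>i\<in>UNIV. x$i * det (two_view_matrix P Q (axis i 1) y))"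
      by (simp add: linear_sum[OF linear_det_two_view_left] linear_cmul[OF linear_det_two_view_left])
    also have "\<dots> = (\<Sum>i\<in>UNIV. x$i *
        det (two_view_matrix P Q (axis i 1) (\<Sum>j\<in>UNIV. y$j *\<^sub>R axis j 1)))"
      using basis_expansion[of y] by (simp only: scalar_mult_eq_scaleR)
    also have "\<dots> = (\<Sum>i\<in>UNIV. x$i * (\<Sum>j\<in>UNIV. y$j *
        det (two_view_matrix P Q (axis i 1) (axis j 1))))"
      by (simp add: linear_sum[OF linear_det_two_view_right] linear_cmul[OF linear_det_two_view_right])
    also have "\<dots> = x \<bullet> (F *v y)"
      by (simp add: inner_vec_def matrix_vector_mult_def F_def mult.commute)
    finally show ?thesis .
  qed
  then show "\<forall>x y. det (two_view_matrix P Q x y) = x \<bullet> (F *v y)" by blast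
  fix G :: "real^3^3"
  assume G: "\<forall>x y. det (two_view_matrix P Q x y) = x \<bullet> (G *v y)"
  have "G $ i $ j = F $ i $ j" for i j
    using G by (simp add: F_def inner_axis' matrix_vector_mul_component inner_axis)
  then show "G = F" by (simp add: vec_eq_iff)
qed

lemma det_two_view_matrix: "det (two_view_matrix P Q x y) = x \<bullet> (\<psi> P Q *v y)"
  using theI'[OF ex1_\<psi>[of P Q]] unfolding \<psi>_def by blast

(* I is the set of index pairs (i, j) for which F i j is given, so Field I is the set of
   indices that occur. *)
definition compatible :: "('i \<times> 'i) set \<Rightarrow> ('i \<Rightarrow> 'i \<Rightarrow> real^3^3) \<Rightarrow> bool" where
  "compatible I F \<longleftrightarrow>
     (\<exists>P. (\<forall>i\<in>Field I. camera (P i)) \<and>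
          (\<forall>(i, j)\<in>I. eq_up_to_scale (F i j) (\<psi> (P i) (P j))))"

(* For F = F^{ij} the vectors e with this property represent the epipole e_j^i, which lies
   in the j-th image: the bilinear form is x \<bullet> (F *v y), with y in the j-th image. *)
definition epipole :: "real^3^3 \<Rightarrow> real^3 \<Rightarrow> bool" where
  "epipole F e \<longleftrightarrow> span {e} = {y. F *v y = 0}"

end

theory Submission
  imports Defs
begin

text \<open>
  Coinciding epipoles force the camera centres onto a common line \<open>L\<close>, and each given
  matrix then only records how the planes through \<open>L\<close> are seen as lines through the epipoles
  of the two images. Compatibility of the triple \<open>(1, j, k)\<close> says that the matching of lines
  between the images \<open>j\<close> and \<open>k\<close> factors through image 1: if \<open>F\<^sup>1\<^sup>j y\<close> and \<open>F\<^sup>1\<^sup>k z\<close> are parallel,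
  then \<open>y\<^sup>T F\<^sup>j\<^sup>k z = 0\<close>. Conversely these relations suffice: cameras with distinct centres on a
  fixed line, normalised against image 1, realise all six matrices at once. Throughout, matrices
  are compared through the zero sets of their bilinear forms, which determine a nonzero form up
  to scale, and a zero of \<open>\<psi> P Q\<close> is a null vector of the two-view matrix from either side.
\<close>

unbundle cross3_syntax

section \<open>Coordinates in dimensions four and six\<close>

lemma UNIV_6: "UNIV = {1, 2, 3, 4, 5, 6::6}"
  using exhaust_6 by auto

lemma sum_6: "sum f (UNIV::6 set) = f 1 + f 2 + f 3 + f 4 + f 5 + f 6"
  unfolding UNIV_6 by (simp add: ac_simps)

lemma vector_4:
  "(vector [a,b,c,d] :: 'a::zero^4)$1 = a"
  "(vector [a,b,c,d] :: 'a^4)$2 = b"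
  "(vector [a,b,c,d] :: 'a^4)$3 = c"
  "(vector [a,b,c,d] :: 'a^4)$4 = d"
  unfolding vector_def by simp_all

lemma matrix_linear_mult:
  fixes f :: "real^'n \<Rightarrow> real^'m"
  shows "linear f \<Longrightarrow> matrix f *v x = f x"
  by (simp add: matrix_works linear_matrix_vector_mul_eq)

section \<open>Zeros of \<open>\<psi>\<close> as null vectors of the two-view matrix\<close>

lemma det_eq_0_iff_null_vector:
  fixes A :: "real^'n^'n"
  shows "det A = 0 \<longleftrightarrow> (\<exists>v. v \<noteq> 0 \<and> A *v v = 0)"
  using det_eq_0_rank[of A] matrix_nonfull_linear_equations_eq[of A] rank_bound[of A]
  by (auto simp: less_le)

text \<open>A null vector \<open>(X, -s, -t)\<close> says that the space point \<open>X\<close> is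
  imaged at \<open>x\<close> and at \<open>y\<close>; \<open>s = 0\<close> or \<open>t = 0\<close>
  admits \<open>X\<close> being a camera centre.\<close>

lemma \<psi>_zero_iff_right_null:
  "x \<bullet> (\<psi> P Q *v y) = 0 \<longleftrightarrow>
    (\<exists>X s t. (X \<noteq> 0 \<or> s \<noteq> 0 \<or> t \<noteq> 0) \<and> P *v X = s *\<^sub>R x \<and> Q *v X = t *\<^sub>R y)"
  (is "_ \<longleftrightarrow> ?rhs")
proof -
  let ?A = "two_view_matrix P Q x y"
  have mult: "?A *v v = vector
      [(P *v X - s *\<^sub>R x)$1, (P *v X - s *\<^sub>R x)$2, (P *v X - s *\<^sub>R x)$3,
       (Q *v X - t *\<^sub>R y)$1, (Q *v X - t *\<^sub>R y)$2, (Q *v X - t *\<^sub>R y)$3]"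
    if "X = vector [v$1, v$2, v$3, v$4]" "s = - v$5" "t = - v$6" for v X s t
    unfolding that vec_eq_iff forall_6
    by (simp only: matrix_vector_mult_def sum_6 sum_4 two_view_matrix_def vector_6 vector_4
        vec_lambda_beta vector_minus_component vector_scaleR_component real_scaleR_def
        mult_minus_left mult_minus_right diff_minus_eq_add mult_zero_left add_0_left add_0_right mult.commute)
  have eq: "?A *v v = 0 \<longleftrightarrow> P *v X = s *\<^sub>R x \<and> Q *v X = t *\<^sub>R y"
    if "X = vector [v$1, v$2, v$3, v$4]" "s = - v$5" "t = - v$6" for v X s t
    unfolding mult[OF that] vec_eq_iff forall_6 forall_3 vector_6
    by (simp only: vector_minus_component zero_index right_minus_eq conj_assoc)
  have "?rhs" if det: "det ?A = 0"
  proof -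
    obtain v where v: "v \<noteq> 0" "?A *v v = 0"
      using det unfolding det_eq_0_iff_null_vector by blast
    let ?X = "vector [v$1, v$2, v$3, v$4] :: real^4"
    have "?X \<noteq> 0 \<or> - v$5 \<noteq> 0 \<or> - v$6 \<noteq> 0"
      using v(1) by (auto simp: vec_eq_iff forall_6 forall_4 vector_4)
    then show ?thesis using eq[of ?X v, OF refl refl refl] v(2) by blast
  qed
  moreover have "det ?A = 0" if null: ?rhs
  proof -
    obtain X s t where X: "X \<noteq> 0 \<or> s \<noteq> 0 \<or> t \<noteq> 0" "P *v X = s *\<^sub>R x" "Q *v X = t *\<^sub>R y"
      using null by blast
    let ?v = "vector [X$1, X$2, X$3, X$4, -s, -t] :: real^6"
    have "?v \<noteq> 0"
      using X(1) by (auto simp: vec_eq_iff forall_6 forall_4 vector_6)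
    moreover have "?A *v ?v = 0"
      by (subst eq[of X _ s t]) (use X in \<open>auto simp: vec_eq_iff forall_4 vector_4 vector_6\<close>)
    ultimately show ?thesis unfolding det_eq_0_iff_null_vector by blast
  qed
  ultimately show ?thesis unfolding det_two_view_matrix by (rule iffI)
qed

text \<open>In a left null vector \<open>(p, -q)\<close>, the image lines \<open>p\<close> through
  \<open>x\<close> and \<open>q\<close> through \<open>y\<close> back-project to the same plane
  \<open>p v* P = q v* Q\<close>.\<close>

lemma \<psi>_zero_iff_left_null:
  "x \<bullet> (\<psi> P Q *v y) = 0 \<longleftrightarrow>
    (\<exists>p q. (p \<noteq> 0 \<or> q \<noteq> 0) \<and> p v* P = q v* Q \<and> p \<bullet> x = 0 \<and> q \<bullet> y = 0)"
  (is "_ \<longleftrightarrow> ?rhs")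
proof -
  let ?A = "transpose (two_view_matrix P Q x y)"
  have mult: "?A *v v = vector
      [(p v* P - q v* Q)$1, (p v* P - q v* Q)$2, (p v* P - q v* Q)$3, (p v* P - q v* Q)$4,
       p \<bullet> x, - (q \<bullet> y)]"
    if "p = vector [v$1, v$2, v$3]" "q = - vector [v$4, v$5, v$6]" for v p q
    unfolding that vec_eq_iff forall_6 transpose_matrix_vector
    by (simp only: vector_matrix_mult_def sum_6 sum_3 two_view_matrix_def vector_6 vector_3
        vec_lambda_beta vector_minus_component vector_uminus_component inner_vec_def inner_real_def)
      (simp only: mult_minus_left mult_minus_right minus_add_distrib minus_minus diff_conv_add_uminus
        mult_zero_left add_0_left add_0_right add.assoc mult.commute)
  have eq: "?A *v v = 0 \<longleftrightarrow> p v* P = q v* Q \<and> p \<bullet> x = 0 \<and> q \<bullet> y = 0"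
    if "p = vector [v$1, v$2, v$3]" "q = - vector [v$4, v$5, v$6]" for v p q
    unfolding mult[OF that] vec_eq_iff forall_6 forall_4 vector_6
    by (simp only: vector_minus_component zero_index right_minus_eq neg_equal_0_iff_equal conj_assoc)
  have "?rhs" if det: "det ?A = 0"
  proof -
    obtain v where v: "v \<noteq> 0" "?A *v v = 0"
      using det unfolding det_eq_0_iff_null_vector by blast
    let ?p = "vector [v$1, v$2, v$3] :: real^3" and ?q = "- vector [v$4, v$5, v$6] :: real^3"
    have "?p \<noteq> 0 \<or> ?q \<noteq> 0"
      using v(1) by (auto simp: vec_eq_iff forall_6 forall_3 vector_3)
    then show ?thesis using eq[of ?p v ?q, OF refl refl] v(2) by blast
  qed
  moreover have "det ?A = 0" if null: ?rhs
  proof -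
    obtain p q where pq: "p \<noteq> 0 \<or> q \<noteq> 0" "p v* P = q v* Q" "p \<bullet> x = 0" "q \<bullet> y = 0"
      using null by blast
    let ?v = "vector [p$1, p$2, p$3, -q$1, -q$2, -q$3] :: real^6"
    have "?v \<noteq> 0"
      using pq(1) by (auto simp: vec_eq_iff forall_6 forall_3 vector_6)
    moreover have "?A *v ?v = 0"
      by (subst eq[of p _ q]) (use pq in \<open>auto simp: vec_eq_iff forall_3 vector_3 vector_6\<close>)
    ultimately show ?thesis unfolding det_eq_0_iff_null_vector by blast
  qed
  ultimately show ?thesis unfolding det_transpose det_two_view_matrix by (rule iffI)
qed

section \<open>Bilinear forms compared by their zero sets\<close>

lemma bilinear_form_eq_0_imp:
  fixes G :: "real^'n^'m"
  assumes "\<And>x y. x \<bullet> (G *v y) = 0"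
  shows "G = 0"
proof -
  have "G *v y = 0" for y
    using assms[of "G *v y" y] by simp
  then show ?thesis by (simp add: matrix_eq)
qed

lemma scalar_multiple_if_zeros_subset:
  fixes F G :: "real^'n^'m"
  assumes "F \<noteq> 0"
    and sub: "\<And>x y. x \<bullet> (F *v y) = 0 \<Longrightarrow> x \<bullet> (G *v y) = 0"
  obtains c where "G = c *\<^sub>R F"
proof -
  obtain x1 y0 where ne: "x1 \<bullet> (F *v y0) \<noteq> 0"
    using bilinear_form_eq_0_imp[of F] assms(1) by blast
  \<comment> \<open>The form of \<open>F\<close> is normalised to 1 at \<open>(x0, y0)\<close>, so
    \<open>c\<close> is the only possible factor; it remains to show that \<open>D\<close> vanishes
    identically.\<close>
  define x0 where "x0 = x1 /\<^sub>R (x1 \<bullet> (F *v y0))"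
  define c where "c = x0 \<bullet> (G *v y0)"
  define D where "D = G - c *\<^sub>R F"
  have F00: "x0 \<bullet> (F *v y0) = 1"
    using ne by (simp add: x0_def)
  have D: "x \<bullet> (D *v y) = x \<bullet> (G *v y) - c * (x \<bullet> (F *v y))" for x y
    by (simp add: D_def matrix_vector_mult_diff_rdistrib inner_diff_right scaleR_matrix_vector_assoc[symmetric])
  have sub': "x \<bullet> (D *v y) = 0" if "x \<bullet> (F *v y) = 0" for x y
    using sub that by (simp add: D)
  have D00: "x0 \<bullet> (D *v y0) = 0"
    by (simp add: D c_def F00)
  have Dx0: "x \<bullet> (D *v y0) = 0" for x
    using sub'[of "x - (x \<bullet> (F *v y0)) *\<^sub>R x0" y0] D00 F00 by (simp add: inner_diff_left)
  have D0y: "x0 \<bullet> (D *v y) = 0" for y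
    using sub'[of x0 "y - (x0 \<bullet> (F *v y)) *\<^sub>R y0"] D00 F00
    by (simp add: inner_diff_right matrix_vector_mult_diff_distrib matrix_vector_mult_scaleR)
  have "x \<bullet> (D *v y) = 0" for x y
  proof -
    \<comment> \<open>\<open>s\<close> makes the form of \<open>F\<close> equal to 1 at
      \<open>(?x, y0)\<close>, so a multiple of \<open>y0\<close> can cancel its value at
      \<open>(?x, y)\<close>; by \<open>Dx0\<close> and \<open>D0y\<close> neither shift changes
      \<open>D\<close>.\<close>
    define s where "s = 1 - x \<bullet> (F *v y0)"
    define t where "t = - (x \<bullet> (F *v y) + s * (x0 \<bullet> (F *v y)))"
    let ?x = "x + s *\<^sub>R x0" and ?y = "y + t *\<^sub>R y0"
    have "?x \<bullet> (F *v ?y) =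
        x \<bullet> (F *v y) + s * (x0 \<bullet> (F *v y)) + t * (x \<bullet> (F *v y0) + s)"
      by (simp add: inner_add_left inner_add_right matrix_vector_right_distrib
          matrix_vector_mult_scaleR F00 algebra_simps)
    also have "\<dots> = 0" by (simp add: s_def t_def)
    finally have "?x \<bullet> (D *v ?y) = 0" by (rule sub')
    then show ?thesis
      by (simp add: inner_add_left inner_add_right matrix_vector_right_distrib
          matrix_vector_mult_scaleR Dx0 D0y)
  qed
  then have "D = 0" by (rule bilinear_form_eq_0_imp)
  then show ?thesis using that[of c] by (simp add: D_def)
qed

text \<open>One inclusion suffices, since \<open>G = 0\<close> would make every pair a zero of
  \<open>F\<close>. This avoids computing any \<open>\<psi>\<close> matrix.\<close>

lemma eq_up_to_scale_if_zeros_subset: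
  fixes F G :: "real^'n^'m"
  assumes "F \<noteq> 0"
    and sub: "\<And>x y. x \<bullet> (G *v y) = 0 \<Longrightarrow> x \<bullet> (F *v y) = 0"
  shows "eq_up_to_scale F G"
proof -
  have "G \<noteq> 0"
    using bilinear_form_eq_0_imp[of F] sub assms(1) by auto
  then obtain c where "F = c *\<^sub>R G"
    using sub by (rule scalar_multiple_if_zeros_subset)
  then show ?thesis
    using assms(1) unfolding eq_up_to_scale_def by auto
qed

lemma eq_up_to_scale_zero_iff:
  fixes F G :: "real^'n^'m"
  assumes "eq_up_to_scale F G"
  shows "x \<bullet> (F *v y) = 0 \<longleftrightarrow> x \<bullet> (G *v y) = 0"
  using assms by (auto simp: eq_up_to_scale_def scaleR_matrix_vector_assoc[symmetric])

text \<open>The right-null description is symmetric in the two cameras, so no sign of a determinant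
  has to be tracked.\<close>

lemma eq_up_to_scale_transpose_\<psi>:
  assumes "eq_up_to_scale F (\<psi> P Q)" and "F \<noteq> 0"
  shows "eq_up_to_scale (transpose F) (\<psi> Q P)"
proof (rule eq_up_to_scale_if_zeros_subset)
  show "transpose F \<noteq> 0"
    using assms(2) by (simp add: vec_eq_iff transpose_def) blast
  fix x y assume "x \<bullet> (\<psi> Q P *v y) = 0"
  then have "y \<bullet> (\<psi> P Q *v x) = 0"
    unfolding \<psi>_zero_iff_right_null by blast
  then have "y \<bullet> (F *v x) = 0"
    using eq_up_to_scale_zero_iff[OF assms(1)] by simp
  then show "x \<bullet> (transpose F *v y) = 0"
    by (simp add: dot_lmul_matrix inner_commute[of x])
qed

section \<open>Epipoles as kernel vectors\<close>

lemma fundamental_matrix_nonzero: "fundamental_matrix F \<Longrightarrow> F \<noteq> 0"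
  by (auto simp: fundamental_matrix_def)

lemma epipole_nonzero:
  assumes "fundamental_matrix F" and "epipole F e"
  shows "e \<noteq> 0"
proof
  assume "e = 0"
  then have "{y. F *v y = 0} = {0}"
    using assms(2) by (simp add: epipole_def)
  then have "\<nexists>x. x \<noteq> 0 \<and> F *v x = 0" by blast
  then have "rank F = 3"
    unfolding matrix_nonfull_linear_equations_eq by simp
  with assms(1) show False by (simp add: fundamental_matrix_def)
qed

lemma epipole_transpose_iff:
  assumes "epipole (transpose F) e"
  shows "(\<forall>y. v \<bullet> (F *v y) = 0) \<longleftrightarrow> v \<in> span {e}"
proof -
  have "(\<forall>y. v \<bullet> (F *v y) = 0) \<longleftrightarrow> v v* F = 0"
    by (metis dot_lmul_matrix inner_eq_zero_iff inner_zero_left)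
  then show ?thesis using assms by (simp add: epipole_def)
qed

section \<open>Line transfer within a compatible triple\<close>

lemma camera_left_kernel:
  assumes "camera P" and "p v* P = 0"
  shows "p = 0"
proof -
  have "rank (transpose P) = CARD(3)"
    using assms(1) by (simp add: camera_def rank_transpose)
  then show ?thesis
    using matrix_nonfull_linear_equations_eq[of "transpose P"] assms(2) by auto
qed

lemma camera_centre:
  fixes P :: "real^4^3"
  obtains c where "c \<noteq> 0" and "P *v c = 0"
  using matrix_nonfull_linear_equations_eq[of P] rank_bound[of P] by auto

text \<open>At most one line joins two distinct image points: \<open>n\<close> passes through
  \<open>e\<close> and \<open>e \<times> n\<close>, which are independent because \<open>n\<close>
  is nonzero and orthogonal to \<open>e\<close>.\<close>

lemma orthogonal_to_cross_multiple:
  fixes p e n :: "real^3"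
  assumes "p \<bullet> e = 0" and "p \<bullet> (e \<times> n) = 0" and "n \<bullet> e = 0" and "e \<noteq> 0" and "n \<noteq> 0"
  shows "p = ((p \<bullet> n) / (n \<bullet> n)) *\<^sub>R n"
proof -
  have "e \<times> (p \<times> n) = (e \<bullet> n) *\<^sub>R p - (e \<bullet> p) *\<^sub>R n"
    by (simp add: Lagrange)
  also have "\<dots> = 0" using assms by (simp add: inner_commute)
  finally have 1: "e \<times> (p \<times> n) = 0" .
  have 2: "e \<bullet> (p \<times> n) = 0"
    using assms(2) by (metis cross_triple inner_commute cross_skew inner_minus_left neg_equal_0_iff_equal)
  have "p \<times> n = 0"
    using norm_and_cross_eq_0[of e "p \<times> n"] 1 2 assms(4) by simp
  then have "0 = n \<times> (p \<times> n)" by simp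
  also have "\<dots> = (n \<bullet> n) *\<^sub>R p - (n \<bullet> p) *\<^sub>R n" by (rule Lagrange)
  finally have "(n \<bullet> n) *\<^sub>R p = (p \<bullet> n) *\<^sub>R n"
    by (simp add: inner_commute)
  then have "(n \<bullet> n) *\<^sub>R p = (n \<bullet> n) *\<^sub>R (((p \<bullet> n) / (n \<bullet> n)) *\<^sub>R n)"
    using assms(5) by simp
  then show ?thesis
    using assms(5) by (metis inner_eq_zero_iff scaleR_cancel_left)
qed

lemma collinear_transfer:
  assumes "fundamental_matrix F12" "fundamental_matrix F13"
    and e2: "epipole (transpose F12) e" and e3: "epipole (transpose F13) e"
    and cams: "camera P1" "camera P2" "camera P3"
    and F12: "eq_up_to_scale F12 (\<psi> P1 P2)" and F13: "eq_up_to_scale F13 (\<psi> P1 P3)"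
    and F23: "eq_up_to_scale F23 (\<psi> P2 P3)"
    and parallel: "(F12 *v y) \<times> (F13 *v z) = 0"
  shows "y \<bullet> (F23 *v z) = 0"
proof -
  have e: "e \<noteq> 0"
    using assms(1) e2 by (intro epipole_nonzero[of "transpose F12"])
      (simp_all add: fundamental_matrix_def rank_transpose)
  have ker: "e \<bullet> (F12 *v y) = 0" "e \<bullet> (F13 *v z) = 0"
    using epipole_transpose_iff[OF e2, of e] epipole_transpose_iff[OF e3, of e] by (auto simp: span_base)
  \<comment> \<open>\<open>n\<close> is a line through \<open>e\<close> matching both
    \<open>y\<close> and \<open>z\<close>. The point \<open>e \<times> n\<close> lies on it and,
    together with \<open>e\<close>, determines it.\<close>
  obtain n where n: "n \<noteq> 0" "n \<bullet> e = 0"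
    and x: "(e \<times> n) \<bullet> (F12 *v y) = 0" "(e \<times> n) \<bullet> (F13 *v z) = 0"
  proof -
    note goal = that
    have thesis if "n \<noteq> 0" "n \<bullet> e = 0" "n \<times> (F12 *v y) = 0" "n \<times> (F13 *v z) = 0" for n
    proof -
      have "(e \<times> n) \<bullet> w = e \<bullet> (n \<times> w)" for w
        by (simp add: cross3_simps)
      then show ?thesis using that goal[of n] by simp
    qed
    note witness = this
    \<comment> \<open>If one vector vanishes, the other provides \<open>n\<close>; if both vanish,
      any line through \<open>e\<close> serves.\<close>
    consider "F12 *v y \<noteq> 0" | "F12 *v y = 0" "F13 *v z \<noteq> 0" | "F12 *v y = 0" "F13 *v z = 0"
      by blast
    then show thesis
    proof cases
      case 1
      then show ?thesis
        using witness[of "F12 *v y"] ker parallel by (simp add: inner_commute)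
    next
      case 2
      then show ?thesis
        using witness[of "F13 *v z"] ker by (simp add: inner_commute)
    next
      case 3
      obtain n where "n \<noteq> 0" "orthogonal e n"
        using orthogonal_to_vector_exists[of e] by auto
      then show ?thesis
        using witness[of n] 3 by (simp add: orthogonal_def inner_commute)
    qed
  qed
  \<comment> \<open>The line \<open>n\<close> of the first image and its match \<open>q\<close> back-project to the same plane; matching it
    with both other images gives the left null vector for \<open>\<psi> P2 P3\<close>.\<close>
  have line: "\<exists>\<alpha> q. \<alpha> \<noteq> 0 \<and> q \<noteq> 0 \<and> (\<alpha> *\<^sub>R n) v* P1 = q v* Q \<and> q \<bullet> w = 0"
    if G: "eq_up_to_scale G (\<psi> P1 Q)" "fundamental_matrix G" "epipole (transpose G) e"
      and Q: "camera Q" and xw: "(e \<times> n) \<bullet> (G *v w) = 0" for G Q w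
  proof -
    obtain p q where pq: "p \<noteq> 0 \<or> q \<noteq> 0" "p v* P1 = q v* Q" "p \<bullet> (e \<times> n) = 0" "q \<bullet> w = 0"
      using xw unfolding eq_up_to_scale_zero_iff[OF G(1)] \<psi>_zero_iff_left_null by blast
    have "p \<noteq> 0" "q \<noteq> 0"
      using pq(1,2) camera_left_kernel[OF Q] camera_left_kernel[OF cams(1)] by force+
    \<comment> \<open>\<open>P1\<close> sees the centre of \<open>Q\<close> at the epipole
      \<open>e\<close>, because that image pairs to zero with every point of the other
      image.\<close>
    obtain c where c: "c \<noteq> 0" "Q *v c = 0" by (rule camera_centre)
    have "\<forall>y. (P1 *v c) \<bullet> (G *v y) = 0"
      unfolding eq_up_to_scale_zero_iff[OF G(1)] \<psi>_zero_iff_right_null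
      using c by (metis scaleR_one scaleR_zero_left)
    then have "P1 *v c \<in> span {e}"
      using epipole_transpose_iff[OF G(3)] by blast
    then obtain k where k: "P1 *v c = k *\<^sub>R e" by (auto simp: span_singleton)
    \<comment> \<open>A common centre of \<open>P1\<close> and \<open>Q\<close> would make
      \<open>\<psi> P1 Q\<close> vanish identically.\<close>
    have "k \<noteq> 0"
    proof
      assume "k = 0"
      with c k have "\<forall>x y. x \<bullet> (\<psi> P1 Q *v y) = 0"
        unfolding \<psi>_zero_iff_right_null by (metis scaleR_zero_left)
      then have "G = 0"
        using bilinear_form_eq_0_imp[of G] eq_up_to_scale_zero_iff[OF G(1)] by blast
      with G(2) show False using fundamental_matrix_nonzero by blast
    qed
    \<comment> \<open>The common plane contains the centre of \<open>Q\<close>, so \<open>p\<close>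
      passes through \<open>e\<close> as well as \<open>e \<times> n\<close>.\<close>
    have "p \<bullet> (P1 *v c) = q \<bullet> (Q *v c)"
      using pq(2) by (metis dot_lmul_matrix)
    then have "p \<bullet> e = 0" using k c(2) \<open>k \<noteq> 0\<close> by simp
    then have "p = ((p \<bullet> n) / (n \<bullet> n)) *\<^sub>R n"
      using pq(3) n e by (intro orthogonal_to_cross_multiple)
    then show ?thesis using pq \<open>p \<noteq> 0\<close> \<open>q \<noteq> 0\<close> by (metis scaleR_zero_left)
  qed
  obtain \<alpha> q where q: "\<alpha> \<noteq> 0" "q \<noteq> 0" "(\<alpha> *\<^sub>R n) v* P1 = q v* P2" "q \<bullet> y = 0"
    using line[OF F12 assms(1) e2 cams(2) x(1)] by blast
  obtain \<beta> r where r: "\<beta> \<noteq> 0" "r \<noteq> 0" "(\<beta> *\<^sub>R n) v* P1 = r v* P3" "r \<bullet> z = 0"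
    using line[OF F13 assms(2) e3 cams(3) x(2)] by blast
  have "(\<beta> *\<^sub>R q) v* P2 = (\<alpha> *\<^sub>R r) v* P3"
    unfolding scaleR_vector_matrix_assoc q(3)[symmetric] r(3)[symmetric] by (simp add: mult.commute)
  then have "y \<bullet> (\<psi> P2 P3 *v z) = 0"
    unfolding \<psi>_zero_iff_left_null
    using q r by (intro exI[of _ "\<beta> *\<^sub>R q"] exI[of _ "\<alpha> *\<^sub>R r"]) auto
  then show ?thesis using eq_up_to_scale_zero_iff[OF F23] by blast
qed

section \<open>Construction of cameras with collinear centres\<close>

lemma cross_right_inverse:
  assumes "fundamental_matrix F" and "epipole (transpose F) e"
  obtains S where "\<And>x. F *v (S *v x) = e \<times> x" and "S *v e = 0"
proof -
  have e: "e \<noteq> 0"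
    using assms by (intro epipole_nonzero[of "transpose F"]) (simp_all add: fundamental_matrix_def rank_transpose)
  \<comment> \<open>The range lies in the plane orthogonal to \<open>e\<close>, and both have
    dimension two; so every \<open>e \<times> x\<close> is attained.\<close>
  have "range ((*v) F) = {u. e \<bullet> u = 0}"
  proof (rule subspace_dim_equal)
    show "subspace (range ((*v) F))"
      by (simp add: linear_subspace_image)
    show "range ((*v) F) \<subseteq> {u. e \<bullet> u = 0}"
      using epipole_transpose_iff[OF assms(2), of e] by (auto simp: span_base)
    show "dim {u. e \<bullet> u = 0} \<le> dim (range ((*v) F))"
      using assms(1) e by (simp add: dim_hyperplane fundamental_matrix_def flip: rank_dim_range)
  qed (rule subspace_hyperplane)
  then have "\<exists>v. F *v v = e \<times> x" for x
    using dot_cross_self(1)[of e x] by (metis (mono_tags, lifting) imageE mem_Collect_eq)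
  then obtain s where s: "\<And>x. F *v s x = e \<times> x" by metis
  define S :: "real^3^3" where "S = (\<chi> i j. s (axis j 1) $ i)"
  have S: "S *v x = (\<Sum>j\<in>UNIV. x$j *\<^sub>R s (axis j 1))" for x
    by (simp add: S_def vec_eq_iff matrix_vector_mult_def mult.commute)
  have "F *v (S *v x) = e \<times> x" for x
  proof -
    have "F *v (S *v x) = (\<Sum>j\<in>UNIV. x$j *\<^sub>R (e \<times> axis j 1))"
      by (simp add: S s linear_sum matrix_vector_mult_scaleR)
    also have "\<dots> = e \<times> x"
      by (simp add: cross3_simps axis_def)
    finally show ?thesis .
  qed
  note FS = this
  \<comment> \<open>Removing the component along \<open>e\<close> first leaves
    \<open>e \<times> x\<close> unchanged and sends \<open>e\<close> itself to 0.\<close>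
  define T where "T = matrix (\<lambda>x. S *v (x - ((e \<bullet> x) / (e \<bullet> e)) *\<^sub>R e))"
  have "linear (\<lambda>x. S *v (x - ((e \<bullet> x) / (e \<bullet> e)) *\<^sub>R e))"
    by (rule linearI)
      (simp_all add: matrix_vector_mult_diff_distrib matrix_vector_right_distrib
        matrix_vector_mult_scaleR inner_add_right add_divide_distrib algebra_simps)
  then have T: "T *v x = S *v (x - ((e \<bullet> x) / (e \<bullet> e)) *\<^sub>R e)" for x
    unfolding T_def 
    by (rule matrix_linear_mult)
  show ?thesis
  proof (rule that)
    show "F *v (T *v x) = e \<times> x" for x
      unfolding T FS by (simp add: Cross3.right_diff_distrib cross_mult_right)
    show "T *v e = 0"
      using e by (simp add: T)
  qed
qed

definition first_three :: "real^4 \<Rightarrow> real^3" where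
  "first_three v = vector [v$1, v$2, v$3]"

lemma linear_first_three: "linear first_three"
  by (rule linearI) (simp_all add: first_three_def vec_eq_iff forall_3 vector_3)

lemma first_three_surj: "\<exists>v. first_three v = x \<and> v$4 = t"
  by (rule exI[of _ "vector [x$1, x$2, x$3, t]"])
    (simp add: first_three_def vec_eq_iff forall_3 vector_3 vector_4)

lemma first_three_eq_0: "first_three v = 0 \<Longrightarrow> v$4 = 0 \<Longrightarrow> v = 0"
  by (simp add: first_three_def vec_eq_iff forall_3 forall_4 vector_3)

text \<open>The camera \<open>[I | 0]\<close>, with centre \<open>(0, 0, 0, 1)\<close>.\<close>

definition reference_camera :: "real^4^3" where
  "reference_camera = matrix first_three"

text \<open>If \<open>S e = 0\<close>, the centre of this camera is \<open>(e, -a (e \<bullet> e))\<close>, so the parameter \<open>a\<close> moves it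
  along the line through \<open>(e, 0)\<close> and the centre \<open>(0, 1)\<close> of the reference camera.\<close>

definition normalised_camera :: "real^3^3 \<Rightarrow> real^3 \<Rightarrow> real^3 \<Rightarrow> real \<Rightarrow> real^4^3" where
  "normalised_camera S e e' a =
     matrix (\<lambda>v. S *v first_three v + (v$4 + a * (e \<bullet> first_three v)) *\<^sub>R e')"

lemma reference_camera_mult: "reference_camera *v v = first_three v"
  unfolding reference_camera_def 
  by (rule matrix_linear_mult[OF linear_first_three])

lemma normalised_camera_mult:
  "normalised_camera S e e' a *v v = S *v first_three v + (v$4 + a * (e \<bullet> first_three v)) *\<^sub>R e'"
proof -
  have "linear (\<lambda>v. S *v first_three v + (v$4 + a * (e \<bullet> first_three v)) *\<^sub>R e')"
    by (rule linearI)
      (simp_all add: linear_add[OF linear_first_three] linear_cmul[OF linear_first_three]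
        matrix_vector_right_distrib matrix_vector_mult_scaleR inner_add_right algebra_simps)
  then show ?thesis unfolding normalised_camera_def 
    by (rule matrix_linear_mult)
qed

lemma camera_if_surj: "surj ((*v) P) \<Longrightarrow> camera P"
  using full_rank_surjective[of P] by (simp add: camera_def)

lemma camera_reference: "camera reference_camera"
proof (rule camera_if_surj)
  show "surj ((*v) reference_camera)"
    unfolding surj_def reference_camera_mult using first_three_surj by metis
qed

text \<open>One image relative to the reference image: \<open>e\<close> is the epipole in the
  reference image, \<open>e'\<close> the one in the other, and \<open>F\<close> maps
  \<open>S *v x\<close> back to the line joining \<open>e\<close> and \<open>x\<close>.\<close>

locale collinear_view =
  fixes F S :: "real^3^3" and e e' :: "real^3"
  assumes e: "e \<noteq> 0" and e': "e' \<noteq> 0"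
    and left: "\<And>y. e \<bullet> (F *v y) = 0"
    and right: "\<And>y. F *v y = 0 \<longleftrightarrow> y \<in> span {e'}"
    and S: "\<And>x. F *v (S *v x) = e \<times> x" and Se: "S *v e = 0"
begin

text \<open>\<open>F\<close> kills the part along \<open>e'\<close>, so the result is the same for
  every parameter \<open>a\<close> and every view with this \<open>e\<close>; this ties the cameras
  to one another.\<close>

lemma F_normalised_camera: "F *v (normalised_camera S e e' a *v v) = e \<times> first_three v"
proof -
  have "F *v e' = 0" using right by (simp add: span_base)
  then show ?thesis
    by (simp add: normalised_camera_mult matrix_vector_right_distrib matrix_vector_mult_scaleR S)
qed

lemma camera_normalised: "camera (normalised_camera S e e' a)"
proof (rule camera_if_surj)
  have "\<exists>v. y = normalised_camera S e e' a *v v" for y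
  proof -
    \<comment> \<open>As \<open>F *v y\<close> is orthogonal to \<open>e\<close>, the triple product
      gives \<open>e \<times> X = F *v y\<close>. The remainder \<open>y - S *v X\<close> is a
      multiple of \<open>e'\<close>, which the fourth coordinate supplies.\<close>
    define X where "X = ((F *v y) \<times> e) /\<^sub>R (e \<bullet> e)"
    have "F *v (y - S *v X) = 0"
      using left[of y] e
      by (simp add: X_def matrix_vector_mult_diff_distrib S cross_mult_right Lagrange)
    then obtain m where m: "y - S *v X = m *\<^sub>R e'"
      unfolding right by (auto simp: span_singleton)
    obtain v where "first_three v = X" "v$4 = m - a * (e \<bullet> X)"
      using first_three_surj by blast
    then have "normalised_camera S e e' a *v v = S *v X + m *\<^sub>R e'"
      by (simp add: normalised_camera_mult)
    then show ?thesis using m by (metis add.commute diff_add_cancel)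
  qed
  then show "surj ((*v) (normalised_camera S e e' a))"
    by (auto simp: surj_def)
qed

lemma eq_up_to_scale_\<psi>_reference:
  assumes "F \<noteq> 0"
  shows "eq_up_to_scale F (\<psi> reference_camera (normalised_camera S e e' a))"
proof (rule eq_up_to_scale_if_zeros_subset[OF assms])
  fix x y
  assume "x \<bullet> (\<psi> reference_camera (normalised_camera S e e' a) *v y) = 0"
  then obtain v s t where nz: "v \<noteq> 0 \<or> s \<noteq> 0 \<or> t \<noteq> 0" and v: "first_three v = s *\<^sub>R x"
    and vt: "normalised_camera S e e' a *v v = t *\<^sub>R y"
    unfolding \<psi>_zero_iff_right_null reference_camera_mult by blast
  have eq: "s *\<^sub>R (e \<times> x) = t *\<^sub>R (F *v y)"
    using F_normalised_camera[of a v] unfolding vt v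
    by (simp add: matrix_vector_mult_scaleR cross_mult_right)
  show "x \<bullet> (F *v y) = 0"
  proof (cases "t = 0")
    case False
    have "t *\<^sub>R (x \<bullet> (F *v y)) = x \<bullet> (s *\<^sub>R (e \<times> x))"
      unfolding eq by simp
    then show ?thesis using False by (simp add: dot_cross_self)
  next
    case True
    \<comment> \<open>With \<open>s = 0\<close> as well, \<open>v\<close> would be a multiple of the
      reference centre, which is seen at \<open>e' \<noteq> 0\<close>. Hence \<open>x\<close> is a
      multiple of the epipole \<open>e\<close>.\<close>
    have "s \<noteq> 0"
    proof
      assume "s = 0"
      then have "v$4 = 0"
        using v vt True e' by (simp add: normalised_camera_mult)
      then show False using first_three_eq_0 v nz True \<open>s = 0\<close> by simp
    qed
    then have "collinear {0, e, x}"
      using eq True by (simp add: cross_eq_0[symmetric])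
    then obtain c where "x = c *\<^sub>R e"
      using e by (auto simp: collinear_lemma)
    then show ?thesis using left by simp
  qed
qed

end

text \<open>For the point \<open>v\<close> behind a zero, \<open>s\<close> times
  \<open>F *v y\<close> and \<open>t\<close> times \<open>F' *v z\<close> both equal
  \<open>e \<times> first_three v\<close>, so the two are parallel and \<open>transfer\<close>
  applies.\<close>

lemma eq_up_to_scale_\<psi>_normalised:
  assumes "collinear_view F S e f" and "collinear_view F' S' e f'"
    and "G \<noteq> 0" and "a \<noteq> b"
    and transfer: "\<And>y z. (F *v y) \<times> (F' *v z) = 0 \<Longrightarrow> y \<bullet> (G *v z) = 0"
  shows "eq_up_to_scale G (\<psi> (normalised_camera S e f a) (normalised_camera S' e f' b))"
proof (rule eq_up_to_scale_if_zeros_subset[OF \<open>G \<noteq> 0\<close>])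
  interpret F: collinear_view F S e f by fact
  interpret F': collinear_view F' S' e f' by fact
  fix y z
  assume "y \<bullet> (\<psi> (normalised_camera S e f a) (normalised_camera S' e f' b) *v z) = 0"
  then obtain v s t where nz: "v \<noteq> 0 \<or> s \<noteq> 0 \<or> t \<noteq> 0"
    and vs: "normalised_camera S e f a *v v = s *\<^sub>R y"
    and vt: "normalised_camera S' e f' b *v v = t *\<^sub>R z"
    unfolding \<psi>_zero_iff_right_null by blast
  have y: "s *\<^sub>R (F *v y) = e \<times> first_three v"
    using F.F_normalised_camera[of a v] unfolding vs by (simp add: matrix_vector_mult_scaleR)
  have z: "t *\<^sub>R (F' *v z) = e \<times> first_three v"
    using F'.F_normalised_camera[of b v] unfolding vt by (simp add: matrix_vector_mult_scaleR)
  \<comment> \<open>Both cameras would have \<open>v\<close> as centre, but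
    \<open>a \<noteq> b\<close> separates their centres.\<close>
  have False if "s = 0" "t = 0"
  proof -
    have "collinear {0, e, first_three v}"
      using y that by (simp add: cross_eq_0[symmetric])
    then obtain c where c: "first_three v = c *\<^sub>R e"
      using F.e by (auto simp: collinear_lemma)
    have 1: "v$4 + a * (c * (e \<bullet> e)) = 0" and 2: "v$4 + b * (c * (e \<bullet> e)) = 0"
      using vs vt that F.e' F'.e'
      by (simp_all add: normalised_camera_mult c matrix_vector_mult_scaleR F.Se F'.Se)
    then have "(a - b) * (c * (e \<bullet> e)) = 0" by algebra
    then have "c = 0" using \<open>a \<noteq> b\<close> F.e by simp
    then show False using 1 c nz that first_three_eq_0[of v] by simp
  qed
  then consider "s \<noteq> 0" "t \<noteq> 0" | "s = 0" "t \<noteq> 0" | "s \<noteq> 0" "t = 0" by blast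
  then have "(F *v y) \<times> (F' *v z) = 0"
  proof cases
    case 1
    have "(s * t) *\<^sub>R ((F *v y) \<times> (F' *v z)) = (s *\<^sub>R (F *v y)) \<times> (t *\<^sub>R (F' *v z))"
      by (simp add: cross_mult_left cross_mult_right)
    also have "\<dots> = 0" unfolding y z by simp
    finally show ?thesis using 1 by simp
  next
    case 2
    then have "F' *v z = 0" using y z by simp
    then show ?thesis by simp
  next
    case 3
    then have "F *v y = 0" using y z by auto
    then show ?thesis by simp
  qed
  then show "y \<bullet> (G *v z) = 0" by (rule transfer)
qed

section \<open>Compatibility of the sextuple and of its triples\<close>

lemma epipole_rescale:
  assumes "epipole F e" and "eq_up_to_scale e' e"
  shows "epipole F e'"
proof -
  obtain c where c: "c \<noteq> 0" "e' = c *\<^sub>R e"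
    using assms(2) by (auto simp: eq_up_to_scale_def)
  have "span {e'} = span {e}"
    by (rule span_eq[THEN iffD2])
      (use c in \<open>auto simp: span_singleton intro: range_eqI[of _ _ "inverse c"]\<close>)
  then show ?thesis using assms(1) by (simp add: epipole_def)
qed

(* F i j is F^{ij}; e i j is the epipole e_j^i, the i-th epipole in the j-th image. *)
theorem theorem3p14:
  fixes F :: "nat \<Rightarrow> nat \<Rightarrow> real^3^3"
    and e :: "nat \<Rightarrow> nat \<Rightarrow> real^3"
  assumes fundamental: "\<forall>i\<in>{1..4}. \<forall>j\<in>{1..4}. i < j \<longrightarrow> fundamental_matrix (F i j)"
    and convention: "\<forall>i\<in>{1..4}. \<forall>j\<in>{1..4}. i < j \<longrightarrow> F j i = transpose (F i j)"
    and epipoles: "\<forall>i\<in>{1..4}. \<forall>j\<in>{1..4}. i \<noteq> j \<longrightarrow> epipole (F i j) (e i j)"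
    and coincide: "\<forall>j\<in>{1..4}. \<forall>i\<in>{1..4} - {j}. \<forall>k\<in>{1..4} - {j}. eq_up_to_scale (e i j) (e k j)"
  shows "compatible {(i, j). 1 \<le> i \<and> i < j \<and> j \<le> 4} F \<longleftrightarrow>
    (\<forall>i\<in>{1..4}. \<forall>j\<in>{1..4}. \<forall>k\<in>{1..4}. distinct [i, j, k] \<longrightarrow>
       compatible {(i, j), (i, k), (j, k)} F)"
proof
  assume "compatible {(i, j). 1 \<le> i \<and> i < j \<and> j \<le> 4} F"
  then obtain P where
    cam: "\<forall>i\<in>Field {(i, j). 1 \<le> i \<and> i < j \<and> j \<le> 4}. camera (P i)"
    and less: "\<forall>(i, j)\<in>{(i, j). 1 \<le> i \<and> i < j \<and> j \<le> 4}. eq_up_to_scale (F i j) (\<psi> (P i) (P j))"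
    unfolding compatible_def by blast
  have cam': "camera (P i)" if "i \<in> {1..4}" for i
  proof -
    \<comment> \<open>Cameras are given only for indices that occur: each other index is paired with
      4, and 4 with 1.\<close>
    have "(if i = 4 then (1, i) else (i, 4)) \<in> {(i, j). 1 \<le> i \<and> i < j \<and> j \<le> (4::nat)}"
      using that by auto
    then have "i \<in> Field {(i, j). 1 \<le> i \<and> i < j \<and> j \<le> (4::nat)}"
      by (auto simp: Field_def split: if_splits)
    then show ?thesis using cam by blast
  qed
  \<comment> \<open>Triples come in any order, so reversed pairs are needed too; they follow by
    transposition.\<close>
  have rel: "eq_up_to_scale (F i j) (\<psi> (P i) (P j))" if "i \<in> {1..4}" "j \<in> {1..4}" "i \<noteq> j" for i j
  proof (cases "i < j")
    case True
    then show ?thesis using less that by auto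
  next
    case False
    then have "eq_up_to_scale (F j i) (\<psi> (P j) (P i))" "F j i \<noteq> 0" "F i j = transpose (F j i)"
      using less that fundamental convention fundamental_matrix_nonzero by auto
    then show ?thesis using eq_up_to_scale_transpose_\<psi> by metis
  qed
  show "\<forall>i\<in>{1..4}. \<forall>j\<in>{1..4}. \<forall>k\<in>{1..4}. distinct [i, j, k] \<longrightarrow>
       compatible {(i, j), (i, k), (j, k)} F"
  proof (intro ballI impI)
    fix i j k :: nat
    assume *: "i \<in> {1..4}" "j \<in> {1..4}" "k \<in> {1..4}" "distinct [i, j, k]"
    have "\<forall>i\<in>Field {(i, j), (i, k), (j, k)}. camera (P i)"
      using * cam' by (auto simp: Field_def)
    moreover have "\<forall>(i, j)\<in>{(i, j), (i, k), (j, k)}. eq_up_to_scale (F i j) (\<psi> (P i) (P j))"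
      using * rel by simp
    ultimately show "compatible {(i, j), (i, k), (j, k)} F"
      unfolding compatible_def by (intro exI[of _ P] conjI)
  qed
next
  assume triples: "\<forall>i\<in>{1..4}. \<forall>j\<in>{1..4}. \<forall>k\<in>{1..4}. distinct [i, j, k] \<longrightarrow>
       compatible {(i, j), (i, k), (j, k)} F"
  \<comment> \<open>All views must share one vector for the common epipole in image 1.\<close>
  define c where "c = e 2 1"
  have fund: "fundamental_matrix (F 1 j)" if "j \<in> {2..4}" for j
    using fundamental that by auto
  have left: "epipole (transpose (F 1 j)) c" if "j \<in> {2..4}" for j
  proof -
    have "F j 1 = transpose (F 1 j)" using convention that by auto
    moreover have "epipole (F j 1) (e j 1)" using epipoles that by auto
    moreover have "eq_up_to_scale c (e j 1)" unfolding c_def using coincide that by auto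
    ultimately show ?thesis using epipole_rescale by simp
  qed
  have right: "epipole (F 1 j) (e 1 j)" if "j \<in> {2..4}" for j
    using epipoles that by auto
  have "\<exists>S. collinear_view (F 1 j) S c (e 1 j)" if j: "j \<in> {2..4}" for j
  proof -
    obtain S where S: "\<And>x. F 1 j *v (S *v x) = c \<times> x" "S *v c = 0"
      using cross_right_inverse[OF fund[OF j] left[OF j]] by blast
    have "c \<noteq> 0"
      using fund[OF j] left[OF j] epipole_nonzero[of "transpose (F 1 j)" c]
      by (simp add: fundamental_matrix_def rank_transpose)
    moreover have "c \<bullet> (F 1 j *v y) = 0" for y
      using epipole_transpose_iff[OF left[OF j], of c] by (simp add: span_base)
    moreover have "F 1 j *v y = 0 \<longleftrightarrow> y \<in> span {e 1 j}" for y
      using right[OF j] by (simp add: epipole_def)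
    ultimately show ?thesis
      using S epipole_nonzero[OF fund[OF j] right[OF j]] by (blast intro: collinear_view.intro)
  qed
  then obtain S where view: "\<And>j. j \<in> {2..4} \<Longrightarrow> collinear_view (F 1 j) (S j) c (e 1 j)"
    by metis
  \<comment> \<open>The distinct parameters \<open>real i\<close> separate the centres of the three
    cameras other than the reference.\<close>
  define P where "P i =
    (if i = 1 then reference_camera else normalised_camera (S i) c (e 1 i) (real i))" for i
  have "camera (P i)" if "i \<in> {1..4}" for i
  proof (cases "i = 1")
    case True
    then show ?thesis by (simp add: P_def camera_reference)
  next
    case False
    with that have "collinear_view (F 1 i) (S i) c (e 1 i)" by (intro view) auto
    with False show ?thesis by (simp add: P_def collinear_view.camera_normalised)
  qed
  moreover have "eq_up_to_scale (F i j) (\<psi> (P i) (P j))" if ij: "1 \<le> i" "i < j" "j \<le> 4" for i j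
  proof (cases "i = 1")
    case True
    with ij have j: "j \<in> {2..4}" by auto
    have "eq_up_to_scale (F 1 j) (\<psi> reference_camera (normalised_camera (S j) c (e 1 j) (real j)))"
      by (rule collinear_view.eq_up_to_scale_\<psi>_reference[OF view[OF j]
            fundamental_matrix_nonzero[OF fund[OF j]]])
    then show ?thesis using True j by (simp add: P_def)
  next
    case False
    with ij have i: "i \<in> {2..4}" and j: "j \<in> {2..4}" by auto
    have ne: "F i j \<noteq> 0"
      using fundamental ij by (intro fundamental_matrix_nonzero) auto
    \<comment> \<open>Joining image 1 to the pair gives the triple whose cameras yield the transfer
      condition.\<close>
    have "compatible {(1, i), (1, j), (i, j)} F"
      using triples i j ij by auto
    then obtain Q where Q: "camera (Q 1)" "camera (Q i)" "camera (Q j)"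
      "eq_up_to_scale (F 1 i) (\<psi> (Q 1) (Q i))" "eq_up_to_scale (F 1 j) (\<psi> (Q 1) (Q j))"
      "eq_up_to_scale (F i j) (\<psi> (Q i) (Q j))"
      unfolding compatible_def by (auto simp: Field_def)
    have "eq_up_to_scale (F i j) (\<psi> (normalised_camera (S i) c (e 1 i) (real i))
        (normalised_camera (S j) c (e 1 j) (real j)))"
      using view[OF i] view[OF j] ne
    proof (rule eq_up_to_scale_\<psi>_normalised)
      show "real i \<noteq> real j" using ij by simp
      show "y \<bullet> (F i j *v z) = 0" if "(F 1 i *v y) \<times> (F 1 j *v z) = 0" for y z
        by (rule collinear_transfer[OF fund[OF i] fund[OF j] left[OF i] left[OF j] Q that])
    qed
    then show ?thesis using False ij by (simp add: P_def)
  qed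
  ultimately show "compatible {(i, j). 1 \<le> i \<and> i < j \<and> j \<le> 4} F"
    unfolding compatible_def by (intro exI[of _ P]) (auto simp: Field_def)
qed

end
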